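(* The family of Abel equations $$\frac{dx}{dt}=(t+x)+b(t)(1+t+x)^3,$$ parametrized by the time-dependent function $b=b(t)$, is a Lie family, and the common time-dependent superposition rule for this Lie family reads $$k=e^{2t}\left((x_0+t+1)^{-2}-(x_1+t+1)^{-2}\right),$$ with $k$ being a real constant. Therefore, given any particular solution $x_1(t)$ of a particular instance of this family of first-order Abel equations, the general solution, $x(t)$, of this instance is $$x(t)=\left((x_1(t)+t+1)^{-2}+k\,e^{-2t}\right)^{-1/2}-t-1 .$$
   Context: A family of non-autonomous systems $\{Y_\alpha\}_{\alpha\in\Lambda}$ of first-order ordinary differential equations on $\mathbb{R}^n$ (here $n=1$) is called a Lie family if it admits a common time-dependent superposition rule: a map $\Phi:\mathbb{R}\times\mathbb{R}^{n(m+1)}\to\mathbb{R}^n$, not depending on $\alpha$, such that the general solution $x(t)$ of any system $Y_\alpha$ of the family can be written, at least for sufficiently small $t$, as $x(t)=\Phi(t,x_{(1)}(t),\ldots,x_{(m)}(t);k_1,\ldots,k_n)$, with $x_{(1)}(t),\ldots,x_{(m)}(t)$ being a generic set of particular solutions of $Y_\alpha$ and $k_1,\ldots,k_n$ being constants associated with each particular solution. Here $m=1$. Superposition maps are in fact defined only locally, on open subsets. The rule is given implicitly by $k=\Psi(t,x_0,x_1)$, where $\Psi(t,x_0(t),x_1(t))$ is constant for any two particular solutions $x_0(t),x_1(t)$ of the same system of the family, and $\Psi$ is obtained by locally inverting $x_0=\Phi(t,x_1;k)$ with respect to $k$. *)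

theory Defs
  imports "HOL-Analysis.Analysis"
begin

text \<open>The space \<open>\<real>\<^sup>n\<close> is any Euclidean space \<open>'a\<close>; tuples of \<open>m\<close> particular solutions are
  functions into \<open>'a ^ 'm\<close>. The right-hand sides and the parameter functions are total functions
  without any regularity requirement; a system on a smaller time domain is obtained by choosing
  the interval \<open>I\<close> accordingly.\<close>

definition solves :: "(real \<Rightarrow> 'a \<Rightarrow> 'a) \<Rightarrow> real set \<Rightarrow> (real \<Rightarrow> 'a::euclidean_space) \<Rightarrow> bool"
  where "solves f I x \<longleftrightarrow>
    open I \<and> is_interval I \<and> (\<forall>t\<in>I. (x has_vector_derivative f t (x t)) (at t))"

text \<open>\<open>\<Phi>\<close>, on the open set \<open>D\<close> of points \<open>(t, x\<^sub>1, \<dots>, x\<^sub>m, k)\<close>, and \<open>\<Psi>\<close>, on the open set \<open>W\<close> of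
  points \<open>(t, x\<^sub>0, x\<^sub>1, \<dots>, x\<^sub>m)\<close>, satisfy
  \<open>x\<^sub>0 = \<Phi>(t, x\<^sub>1, \<dots>, x\<^sub>m; k)\<close> iff \<open>k = \<Psi>(t, x\<^sub>0, x\<^sub>1, \<dots>, x\<^sub>m)\<close>.\<close>

definition inverse_wrt_constants ::
  "(real \<times> ('a::euclidean_space ^ 'm::finite) \<times> 'a) set \<Rightarrow> (real \<times> 'a \<times> ('a^'m)) set \<Rightarrow>
   (real \<times> ('a^'m) \<times> 'a \<Rightarrow> 'a) \<Rightarrow> (real \<times> 'a \<times> ('a^'m) \<Rightarrow> 'a) \<Rightarrow> bool"
  where "inverse_wrt_constants D W \<Phi> \<Psi> \<longleftrightarrow>
    open D \<and> open W \<and> \<Phi> differentiable_on D \<and> \<Psi> differentiable_on W \<and>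
    (\<forall>t y k. (t, y, k) \<in> D \<longrightarrow> (t, \<Phi> (t, y, k), y) \<in> W \<and> \<Psi> (t, \<Phi> (t, y, k), y) = k) \<and>
    (\<forall>t x y. (t, x, y) \<in> W \<longrightarrow> (t, y, \<Psi> (t, x, y)) \<in> D \<and> \<Phi> (t, y, \<Psi> (t, x, y)) = x)"

text \<open>A locally defined common time-dependent superposition rule for the family
  \<open>(Y \<alpha>)\<close>, \<open>\<alpha> \<in> \<Lambda>\<close>. That \<open>\<Phi>\<close> yields the general solution means that it produces
  solutions, and that every solution in general position with respect to the given particular
  ones is so obtained, near each time \<open>t\<^sub>0\<close>, for exactly one value of the constants.\<close>

definition common_superposition_rule ::
  "'i set \<Rightarrow> ('i \<Rightarrow> real \<Rightarrow> 'a \<Rightarrow> 'a) \<Rightarrow>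
   (real \<times> ('a::euclidean_space ^ 'm::finite) \<times> 'a) set \<Rightarrow> (real \<times> 'a \<times> ('a^'m)) set \<Rightarrow>
   (real \<times> ('a^'m) \<times> 'a \<Rightarrow> 'a) \<Rightarrow> (real \<times> 'a \<times> ('a^'m) \<Rightarrow> 'a) \<Rightarrow> bool"
  where "common_superposition_rule \<Lambda> Y D W \<Phi> \<Psi> \<longleftrightarrow>
    inverse_wrt_constants D W \<Phi> \<Psi> \<and>
    (\<forall>\<alpha>\<in>\<Lambda>. \<forall>I y. (\<forall>i. solves (Y \<alpha>) I (\<lambda>t. y t $ i)) \<longrightarrow>
      (\<forall>k. (\<forall>t\<in>I. (t, y t, k) \<in> D) \<longrightarrow> solves (Y \<alpha>) I (\<lambda>t. \<Phi> (t, y t, k))) \<and>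
      (\<forall>x t\<^sub>0. solves (Y \<alpha>) I x \<and> t\<^sub>0 \<in> I \<and> (t\<^sub>0, x t\<^sub>0, y t\<^sub>0) \<in> W \<longrightarrow>
        (\<exists>!k. \<forall>\<^sub>F t in nhds t\<^sub>0. (t, y t, k) \<in> D \<and> x t = \<Phi> (t, y t, k))))"

text \<open>``Generic'' means: in an open dense set of points \<open>(t, x\<^sub>0, x\<^sub>1, \<dots>, x\<^sub>m)\<close>. The type argument
  carries the number \<open>m\<close> of particular solutions.\<close>

definition Lie_family ::
  "'m::finite itself \<Rightarrow> 'i set \<Rightarrow> ('i \<Rightarrow> real \<Rightarrow> 'a::euclidean_space \<Rightarrow> 'a) \<Rightarrow> bool"
  where "Lie_family _ \<Lambda> Y \<longleftrightarrow>
    (\<exists>G :: (real \<times> 'a \<times> ('a^'m)) set. open G \<and> closure G = UNIV \<and>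
      (\<forall>p\<in>G. \<exists>D W \<Phi> \<Psi>. common_superposition_rule \<Lambda> Y D W \<Phi> \<Psi> \<and> p \<in> W))"

definition implicit_superposition_rule ::
  "'i set \<Rightarrow> ('i \<Rightarrow> real \<Rightarrow> 'a \<Rightarrow> 'a) \<Rightarrow>
   (real \<times> 'a \<times> ('a::euclidean_space ^ 'm::finite)) set \<Rightarrow> (real \<times> 'a \<times> ('a^'m) \<Rightarrow> 'a) \<Rightarrow> bool"
  where "implicit_superposition_rule \<Lambda> Y G \<Psi> \<longleftrightarrow>
    open G \<and> closure G = UNIV \<and>
    (\<forall>\<alpha>\<in>\<Lambda>. \<forall>I x y. solves (Y \<alpha>) I x \<and> (\<forall>i. solves (Y \<alpha>) I (\<lambda>t. y t $ i)) \<and>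
        (\<forall>t\<in>I. (t, x t, y t) \<in> G) \<longrightarrow>
      (\<exists>k. \<forall>t\<in>I. k = \<Psi> (t, x t, y t))) \<and>
    (\<forall>p\<in>G. \<exists>D W \<Phi>. common_superposition_rule \<Lambda> Y D W \<Phi> \<Psi> \<and> p \<in> W \<and> W \<subseteq> G)"

definition abel :: "(real \<Rightarrow> real) \<Rightarrow> real \<Rightarrow> real \<Rightarrow> real"
  where "abel b t x = (t + x) + b t * (1 + t + x) ^ 3"

end

theory Submission
  imports Defs
begin

text \<open>Shifting by \<open>u = x + t + 1\<close> turns the Abel equation into the Bernoulli equation
  \<open>u' = u + b u\<^sup>3\<close>, which \<open>v = u\<^sup>-\<^sup>2\<close> linearises to \<open>v' = - 2 v - 2 b\<close>. The parameter function
  \<open>b\<close> only enters as the inhomogeneity of this linear equation. Hence the difference of two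
  solutions \<open>v\<close> for the same \<open>b\<close> satisfies an equation without \<open>b\<close>, so it is
  \<open>k exp (- 2 t)\<close>, and that is the superposition rule.

  The two directions are \<open>abel_first_integral\<close> (the difference of two solutions
  is \<open>k exp (- 2 t)\<close>) and \<open>branch_solves\<close> (adding \<open>k exp (- 2 t)\<close> to a solution \<open>v\<close> and undoing the
  substitution gives a solution). Passing from \<open>u\<close> to \<open>v\<close> forgets the sign of \<open>u\<close>. So the
  substitution has two local inverses, indexed by a sign \<open>s\<close>, and each gives a superposition rule
  \<open>\<Phi>\<close> of its own (lemma \<open>common_rule_abel\<close>). Since \<open>v\<close> is even in \<open>u\<close>, one and the same \<open>\<Psi>\<close> inverts
  both, and together their domains cover the dense open set on which neither \<open>x\<^sub>0 + t + 1\<close> nor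
  \<open>x\<^sub>1 + t + 1\<close> vanishes.\<close>

section \<open>Linearisation of the Abel equations\<close>

lemma powi_minus_two: "(u::real) powi (-2) = inverse (u\<^sup>2)"
  by (simp add: power_int_minus)

lemma abel_linearised:
  assumes "(x has_vector_derivative abel b t (x t)) (at t)" and nz: "x t + t + 1 \<noteq> 0"
  shows "((\<lambda>t. (x t + t + 1) powi (-2)) has_real_derivative
           - 2 * (x t + t + 1) powi (-2) - 2 * b t) (at t)"
proof -
  define u where "u = x t + t + 1"
  have "(x has_real_derivative abel b t (x t)) (at t)"
    using assms(1) by (simp add: has_real_derivative_iff_has_vector_derivative)
  then have u': "((\<lambda>t. x t + t + 1) has_real_derivative u + b t * u ^ 3) (at t)"
    by (auto intro!: derivative_eq_intros simp: abel_def u_def algebra_simps)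
  have "((\<lambda>t. inverse ((x t + t + 1)\<^sup>2)) has_real_derivative
          - (inverse (u\<^sup>2) * (2 * u * (u + b t * u ^ 3)) * inverse (u\<^sup>2))) (at t)"
    unfolding u_def by (rule derivative_eq_intros u' [unfolded u_def] refl | use nz in simp)+
  moreover have "- (inverse (u\<^sup>2) * (2 * u * (u + b t * u ^ 3)) * inverse (u\<^sup>2))
      = - 2 * inverse (u\<^sup>2) - 2 * b t"
  proof -
    have "u \<noteq> 0" using nz by (simp add: u_def)
    then show ?thesis by (simp add: field_simps power2_eq_square power3_eq_cube)
  qed
  ultimately show ?thesis
    by (simp add: powi_minus_two u_def)
qed

text \<open>The factor \<open>exp (2 t)\<close> integrates the homogeneous linear equation satisfied by the
  difference, from which \<open>b\<close> has cancelled.\<close>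

lemma abel_first_integral:
  assumes x: "solves (abel b) I x" and y: "solves (abel b) I y"
    and xnz: "\<And>t. t \<in> I \<Longrightarrow> x t + t + 1 \<noteq> 0" and ynz: "\<And>t. t \<in> I \<Longrightarrow> y t + t + 1 \<noteq> 0"
  shows "\<exists>k. \<forall>t\<in>I. exp (2 * t) * ((x t + t + 1) powi (-2) - (y t + t + 1) powi (-2)) = k"
proof -
  have "((\<lambda>t. exp (2 * t) * ((x t + t + 1) powi (-2) - (y t + t + 1) powi (-2)))
          has_real_derivative 0) (at t within I)" if "t \<in> I" for t
  proof -
    have "((\<lambda>t. (x t + t + 1) powi (-2)) has_real_derivative
        - 2 * (x t + t + 1) powi (-2) - 2 * b t) (at t)"
      using x xnz that by (intro abel_linearised) (auto simp: solves_def)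
    moreover have "((\<lambda>t. (y t + t + 1) powi (-2)) has_real_derivative
        - 2 * (y t + t + 1) powi (-2) - 2 * b t) (at t)"
      using y ynz that by (intro abel_linearised) (auto simp: solves_def)
    moreover have "((\<lambda>t. exp (2 * t)) has_real_derivative 2 * exp (2 * t)) (at t)"
      by (auto intro!: derivative_eq_intros)
    ultimately have "((\<lambda>t. exp (2 * t) * ((x t + t + 1) powi (-2) - (y t + t + 1) powi (-2)))
        has_real_derivative
          2 * exp (2 * t) * ((x t + t + 1) powi (-2) - (y t + t + 1) powi (-2))
          + ((- 2 * (x t + t + 1) powi (-2) - 2 * b t) - (- 2 * (y t + t + 1) powi (-2) - 2 * b t))
              * exp (2 * t)) (at t)"
      by (intro DERIV_mult DERIV_diff)
    then show ?thesis
      by (simp add: algebra_simps has_field_derivative_at_within)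
  qed
  moreover have "convex I"
    using x by (simp add: solves_def is_interval_convex)
  ultimately have "\<exists>c. \<forall>t\<in>I.
      exp (2 * t) * ((x t + t + 1) powi (-2) - (y t + t + 1) powi (-2)) = c"
    by (intro has_field_derivative_zero_constant)
  then show ?thesis by blast
qed

text \<open>Undoing the substitution: \<open>u \<mapsto> u\<^sup>-\<^sup>2\<close> maps each half line \<open>s u > 0\<close> bijectively onto the
  positive half line. The equivalence carries over to \<open>\<Phi>\<close> and \<open>\<Psi>\<close> in \<open>abel_Phi_Psi_iff\<close>.\<close>

lemma eq_branch_iff:
  fixes s u w :: real
  assumes s: "s = 1 \<or> s = -1"
  shows "w > 0 \<and> u = s * w powr (- 1 / 2) \<longleftrightarrow> s * u > 0 \<and> u powi (-2) = w"
proof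
  assume A: "w > 0 \<and> u = s * w powr (- 1 / 2)"
  have "(w powr (- 1 / 2))\<^sup>2 = w powr (- 1)"
    by (simp add: power2_eq_square flip: powr_add)
  with A have "(w powr (- 1 / 2))\<^sup>2 = inverse w"
    by (simp add: powr_minus)
  with A s show "s * u > 0 \<and> u powi (-2) = w"
    by (auto simp: powi_minus_two)
next
  assume A: "s * u > 0 \<and> u powi (-2) = w"
  define r where "r = s * u"
  have r: "r > 0" "u = s * r" "w = r powr (-2)"
    using A s by (auto simp: r_def powi_minus_two powr_minus)
  have "w powr (- 1 / 2) = r"
    unfolding r(3) powr_powr using r(1) by simp
  with r show "w > 0 \<and> u = s * w powr (- 1 / 2)"
    by simp
qed

lemma branch_solves:
  assumes s: "s = 1 \<or> s = -1" and y: "solves (abel b) I y"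
    and nz: "\<And>t. t \<in> I \<Longrightarrow> y t + t + 1 \<noteq> 0"
    and pos: "\<And>t. t \<in> I \<Longrightarrow> (y t + t + 1) powi (-2) + k * exp (- 2 * t) > 0"
    and x: "\<And>t. t \<in> I \<Longrightarrow>
      x t = s * ((y t + t + 1) powi (-2) + k * exp (- 2 * t)) powr (- 1 / 2) - t - 1"
  shows "solves (abel b) I x"
proof -
  have I: "open I" "is_interval I" using y by (auto simp: solves_def)
  define w where "w t = (y t + t + 1) powi (-2) + k * exp (- 2 * t)" for t
  have "(x has_real_derivative abel b t (x t)) (at t)" if t: "t \<in> I" for t
  proof -
    have wpos: "w t > 0" using pos [OF t] by (simp add: w_def)
    have "((\<lambda>t. (y t + t + 1) powi (-2)) has_real_derivative
        - 2 * (y t + t + 1) powi (-2) - 2 * b t) (at t)"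
      using y nz t by (intro abel_linearised) (auto simp: solves_def)
    moreover have "((\<lambda>t. k * exp (- 2 * t)) has_real_derivative - 2 * (k * exp (- 2 * t))) (at t)"
      by (auto intro!: derivative_eq_intros)
    ultimately have "(w has_real_derivative
        (- 2 * (y t + t + 1) powi (-2) - 2 * b t) + - 2 * (k * exp (- 2 * t))) (at t)"
      unfolding w_def by (rule DERIV_add)
    then have w': "(w has_real_derivative - 2 * w t - 2 * b t) (at t)"
      by (simp add: w_def algebra_simps)
    define z where "z = w t powr (- 1 / 2)"
    have "z ^ 3 = w t powr (- 3 / 2)"
      using wpos by (simp add: z_def powr_powr flip: powr_realpow)
    moreover have "w t * w t powr (- 3 / 2) = z"
      using wpos powr_mult_base [of "w t" "- 3 / 2"] by (simp add: z_def)
    ultimately have z3: "w t * z ^ 3 = z" "w t powr (- 1 / 2 - 1) = z ^ 3"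
      by simp_all
    have "((\<lambda>t. w t powr (- 1 / 2)) has_real_derivative
        (- 1 / 2) * w t powr (- 1 / 2 - 1) * (- 2 * w t - 2 * b t)) (at t)"
      by (rule DERIV_chain2 [OF has_real_derivative_powr [OF wpos] w'])
    moreover have "(- 1 / 2) * w t powr (- 1 / 2 - 1) * (- 2 * w t - 2 * b t) = z + b t * z ^ 3"
      unfolding z3(2) using z3(1) by (simp add: algebra_simps)
    ultimately have "((\<lambda>t. w t powr (- 1 / 2)) has_real_derivative z + b t * z ^ 3) (at t)"
      by (rule DERIV_cong)
    then have "((\<lambda>t. s * w t powr (- 1 / 2) - t - 1) has_real_derivative
        s * (z + b t * z ^ 3) - 1 - 0) (at t)"
      by (intro DERIV_diff DERIV_cmult DERIV_ident DERIV_const)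
    moreover have "s * (z + b t * z ^ 3) - 1 - 0 = abel b t (x t)"
      using s x [OF t] by (auto simp: abel_def z_def w_def)
    ultimately have "((\<lambda>t. s * w t powr (- 1 / 2) - t - 1) has_real_derivative abel b t (x t)) (at t)"
      by simp
    then show ?thesis
      by (rule has_field_derivative_transform_within_open [OF _ I(1) t])
        (simp add: x w_def)
  qed
  with I show ?thesis
    by (simp add: solves_def has_real_derivative_iff_has_vector_derivative)
qed

text \<open>The constant \<open>k\<close> is the value of the first integral. The given solution \<open>y\<close> may lie on either
  side of \<open>- t - 1\<close>, because only its even power \<open>(y + t + 1)\<^sup>-\<^sup>2\<close> enters; the side of \<open>x\<close> is
  the sign \<open>s\<close>.\<close>

lemma abel_general_solution:
  assumes s: "s = 1 \<or> s = -1" and y: "solves (abel b) I y"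
    and nz: "\<And>t. t \<in> I \<Longrightarrow> y t + t + 1 \<noteq> 0"
  shows "solves (abel b) I x \<and> (\<forall>t\<in>I. s * (x t + t + 1) > 0) \<longleftrightarrow>
    (\<exists>k. \<forall>t\<in>I. (y t + t + 1) powi (-2) + k * exp (- 2 * t) > 0 \<and>
      x t = s * ((y t + t + 1) powi (-2) + k * exp (- 2 * t)) powr (- 1 / 2) - t - 1)"
    (is "?L \<longleftrightarrow> (\<exists>k. \<forall>t\<in>I. ?w k t > 0 \<and> _)")
proof
  assume L: ?L
  then have "\<And>t. t \<in> I \<Longrightarrow> x t + t + 1 \<noteq> 0" by fastforce
  with L y nz obtain k where
    k: "\<And>t. t \<in> I \<Longrightarrow> exp (2 * t) * ((x t + t + 1) powi (-2) - (y t + t + 1) powi (-2)) = k"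
    using abel_first_integral [of b I x y] by blast
  have "?w k t > 0 \<and> x t = s * ?w k t powr (- 1 / 2) - t - 1" if t: "t \<in> I" for t
  proof -
    have "(x t + t + 1) powi (-2) = ?w k t"
      unfolding k [OF t, symmetric] by (simp add: exp_minus field_simps)
    moreover have "s * (x t + t + 1) > 0" using L t by blast
    ultimately have "?w k t > 0 \<and> x t + t + 1 = s * ?w k t powr (- 1 / 2)"
      using eq_branch_iff [OF s] by blast
    then show ?thesis by linarith
  qed
  then show "\<exists>k. \<forall>t\<in>I. ?w k t > 0 \<and> x t = s * ?w k t powr (- 1 / 2) - t - 1" by blast
next
  assume "\<exists>k. \<forall>t\<in>I. ?w k t > 0 \<and> x t = s * ?w k t powr (- 1 / 2) - t - 1"
  then obtain k where k: "\<And>t. t \<in> I \<Longrightarrow> ?w k t > 0"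
    "\<And>t. t \<in> I \<Longrightarrow> x t = s * ?w k t powr (- 1 / 2) - t - 1" by blast
  have "solves (abel b) I x"
    by (rule branch_solves [OF s y nz k])
  moreover have "s * (x t + t + 1) > 0" if "t \<in> I" for t
  proof -
    have "x t + t + 1 = s * ?w k t powr (- 1 / 2)" using k(2) [OF that] by simp
    then show ?thesis using eq_branch_iff [OF s] k(1) [OF that] by blast
  qed
  ultimately show ?L by blast
qed

section \<open>The two branches of the superposition rule\<close>

definition abel_Psi :: "real \<times> real \<times> (real^1) \<Rightarrow> real" where
  "abel_Psi = (\<lambda>(t, x0, y). exp (2 * t) * ((x0 + t + 1) powi (-2) - (y $ 1 + t + 1) powi (-2)))"

definition abel_Phi :: "real \<Rightarrow> real \<times> (real^1) \<times> real \<Rightarrow> real" where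
  "abel_Phi s = (\<lambda>(t, y, k).
     s * ((y $ 1 + t + 1) powi (-2) + k * exp (- 2 * t)) powr (- 1 / 2) - t - 1)"

definition Phi_dom :: "(real \<times> (real^1) \<times> real) set" where
  "Phi_dom = {(t, y, k). y $ 1 + t + 1 \<noteq> 0 \<and> (y $ 1 + t + 1) powi (-2) + k * exp (- 2 * t) > 0}"

definition Psi_dom :: "real \<Rightarrow> (real \<times> real \<times> (real^1)) set" where
  "Psi_dom s = {(t, x0, y). s * (x0 + t + 1) > 0 \<and> y $ 1 + t + 1 \<noteq> 0}"

lemma abel_Psi_const:
  assumes "solves (abel b) I x" "solves (abel b) I (\<lambda>t. y t $ 1)"
    and "\<And>t. t \<in> I \<Longrightarrow> x t + t + 1 \<noteq> 0" "\<And>t. t \<in> I \<Longrightarrow> y t $ 1 + t + 1 \<noteq> 0"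
  shows "\<exists>k. \<forall>t\<in>I. abel_Psi (t, x t, y t) = k"
  using abel_first_integral [OF assms] unfolding abel_Psi_def prod.case .

text \<open>Multiplying the positivity condition by \<open>(y + t + 1)\<^sup>2\<close> makes its left-hand side continuous
  everywhere.\<close>

lemma open_Phi_dom: "open Phi_dom"
proof -
  have "Phi_dom = {p. fst (snd p) $ 1 + fst p + 1 \<noteq> 0 \<and>
      0 < 1 + snd (snd p) * exp (- 2 * fst p) * (fst (snd p) $ 1 + fst p + 1)\<^sup>2}"
  proof -
    have "inverse (u\<^sup>2) + c > 0 \<longleftrightarrow> 0 < 1 + c * u\<^sup>2" if "u \<noteq> 0" for u c :: real
    proof -
      have "1 + c * u\<^sup>2 = (inverse (u\<^sup>2) + c) * u\<^sup>2" using that by (simp add: field_simps)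
      then show ?thesis using that by (simp add: zero_less_mult_iff)
    qed
    then show ?thesis
      unfolding Phi_dom_def powi_minus_two by (auto simp: case_prod_unfold)
  qed
  also have "open \<dots>"
    by (intro open_Collect_conj open_Collect_neq open_Collect_less continuous_intros)
  finally show ?thesis .
qed

lemma open_Psi_dom: "open (Psi_dom s)"
proof -
  have "Psi_dom s = {p. 0 < s * (fst (snd p) + fst p + 1) \<and> snd (snd p) $ 1 + fst p + 1 \<noteq> 0}"
    by (auto simp: Psi_dom_def)
  also have "open \<dots>"
    by (intro open_Collect_conj open_Collect_neq open_Collect_less continuous_intros)
  finally show ?thesis .
qed

lemma differentiable_inverse_square:
  fixes f :: "'b::real_normed_vector \<Rightarrow> real"
  assumes "f differentiable (at p)" "f p \<noteq> 0"
  shows "(\<lambda>q. f q powi (-2)) differentiable (at p)"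
  unfolding powi_minus_two using assms by (intro differentiable_inverse differentiable_power) auto

lemma differentiable_vec_nth_comp:
  fixes f :: "'b::real_normed_vector \<Rightarrow> real^'n"
  assumes "f differentiable (at p)"
  shows "(\<lambda>q. f q $ i) differentiable (at p)"
  using differentiable_compose [OF bounded_linear_imp_differentiable [OF bounded_linear_vec_nth] assms]
  by simp

lemma differentiable_fst_snd:
  "fst differentiable (at p)" "snd differentiable (at p)"
  by (simp_all add: bounded_linear_imp_differentiable bounded_linear_fst bounded_linear_snd)

lemma differentiable_fst_snd_snd:
  "(\<lambda>q. fst (snd q)) differentiable (at p)" "(\<lambda>q. snd (snd q)) differentiable (at p)"
  using differentiable_compose [OF differentiable_fst_snd(1) differentiable_fst_snd(2)]
    differentiable_compose [OF differentiable_fst_snd(2) differentiable_fst_snd(2)]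
  by blast+

lemma differentiable_exp_comp:
  fixes f :: "'b::real_normed_vector \<Rightarrow> real"
  assumes "f differentiable (at p)"
  shows "(\<lambda>q. exp (f q)) differentiable (at p)"
  by (rule differentiable_compose [OF _ assms])
    (use DERIV_exp real_differentiable_def in blast)

lemma abel_Psi_differentiable: "abel_Psi differentiable_on Psi_dom s"
proof -
  have "abel_Psi differentiable (at p)" if "p \<in> Psi_dom s" for p
    unfolding abel_Psi_def case_prod_unfold
    by (intro differentiable_mult differentiable_diff differentiable_inverse_square
        differentiable_add differentiable_exp_comp differentiable_vec_nth_comp
        differentiable_fst_snd differentiable_fst_snd_snd differentiable_const)
      (use that in \<open>auto simp: Psi_dom_def\<close>)
  then show ?thesis
    by (simp add: differentiable_on_def differentiable_at_withinI)
qed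

lemma abel_Phi_differentiable: "abel_Phi s differentiable_on Phi_dom"
proof -
  have "abel_Phi s differentiable (at p)" if p: "p \<in> Phi_dom" for p
  proof -
    let ?w = "\<lambda>q::real \<times> (real^1) \<times> real.
      (fst (snd q) $ 1 + fst q + 1) powi (-2) + snd (snd q) * exp (- 2 * fst q)"
    have "?w p > 0" using p by (auto simp: Phi_dom_def)
    then have "(\<lambda>z. z powr (- 1 / 2)) differentiable (at (?w p))"
      using has_real_derivative_powr real_differentiable_def by blast
    moreover have "?w differentiable (at p)"
      by (intro differentiable_mult differentiable_diff differentiable_inverse_square
        differentiable_add differentiable_exp_comp differentiable_vec_nth_comp
        differentiable_fst_snd differentiable_fst_snd_snd differentiable_const)
      (use p in \<open>auto simp: Phi_dom_def\<close>)
    ultimately have "(\<lambda>q. ?w q powr (- 1 / 2)) differentiable (at p)"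
      by (rule differentiable_compose)
    then show ?thesis
      unfolding abel_Phi_def case_prod_unfold
      by (intro differentiable_mult differentiable_diff
        differentiable_fst_snd differentiable_const)
  qed
  then show ?thesis
    by (simp add: differentiable_on_def differentiable_at_withinI)
qed

lemma abel_Phi_Psi_iff:
  assumes s: "s = 1 \<or> s = -1"
  shows "(t, y, k) \<in> Phi_dom \<and> x = abel_Phi s (t, y, k) \<longleftrightarrow>
    (t, x, y) \<in> Psi_dom s \<and> k = abel_Psi (t, x, y)"
proof -
  let ?w = "(y $ 1 + t + 1) powi (-2) + k * exp (- 2 * t)"
  have "a = c + k * exp (- 2 * t) \<longleftrightarrow> k = exp (2 * t) * (a - c)" for a c :: real
  proof -
    have "exp (- 2 * t) = inverse (exp (2 * t))" by (simp flip: exp_minus)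
    moreover have "a = c + k * inverse e \<longleftrightarrow> k = e * (a - c)" if "e > 0" for e :: real
      using that by (auto simp: field_simps)
    ultimately show ?thesis by simp
  qed
  then have "(x + t + 1) powi (-2) = ?w \<longleftrightarrow> k = abel_Psi (t, x, y)"
    unfolding abel_Psi_def prod.case .
  moreover have "x = abel_Phi s (t, y, k) \<longleftrightarrow> x + t + 1 = s * ?w powr (- 1 / 2)"
    unfolding abel_Phi_def prod.case by linarith
  ultimately show ?thesis
    using eq_branch_iff [OF s, of ?w "x + t + 1"]
    unfolding Phi_dom_def Psi_dom_def mem_Collect_eq prod.case by blast
qed

lemma inverse_wrt_constants_abel:
  assumes "s = 1 \<or> s = -1"
  shows "inverse_wrt_constants Phi_dom (Psi_dom s) (abel_Phi s) abel_Psi"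
proof -
  have "(t, abel_Phi s (t, y, k), y) \<in> Psi_dom s \<and> abel_Psi (t, abel_Phi s (t, y, k), y) = k"
    if "(t, y, k) \<in> Phi_dom" for t y k
    using abel_Phi_Psi_iff [OF assms, of t y k "abel_Phi s (t, y, k)"] that by simp
  moreover have "(t, y, abel_Psi (t, x, y)) \<in> Phi_dom \<and> abel_Phi s (t, y, abel_Psi (t, x, y)) = x"
    if "(t, x, y) \<in> Psi_dom s" for t x y
    using abel_Phi_Psi_iff [OF assms, of t y "abel_Psi (t, x, y)" x] that by simp
  ultimately show ?thesis
    unfolding inverse_wrt_constants_def
    using open_Phi_dom open_Psi_dom abel_Phi_differentiable abel_Psi_differentiable by simp
qed

lemma solves_subset:
  "solves f I x \<Longrightarrow> open J \<Longrightarrow> is_interval J \<Longrightarrow> J \<subseteq> I \<Longrightarrow> solves f J x"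
  by (auto simp: solves_def)

lemma solves_isCont: "solves f I x \<Longrightarrow> t \<in> I \<Longrightarrow> isCont x t"
  by (auto simp: solves_def intro: has_vector_derivative_continuous)

lemma isCont_tendsto_nhds: "isCont f a \<Longrightarrow> (f \<longlongrightarrow> f a) (nhds a)"
  by (simp add: isCont_def tendsto_at_iff_tendsto_nhds)

text \<open>The constant for a solution \<open>x\<close> is forced at \<open>t\<^sub>0\<close> itself. That it works nearby holds because
  \<open>x\<close> and \<open>y\<close> stay in the domain on a small interval, where \<open>abel_first_integral\<close> applies.\<close>

lemma common_rule_abel:
  assumes s: "s = 1 \<or> s = -1"
  shows "common_superposition_rule UNIV abel Phi_dom (Psi_dom s) (abel_Phi s) abel_Psi"
proof -
  have "solves (abel b) I (\<lambda>t. abel_Phi s (t, y t, k))"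
    if "solves (abel b) I (\<lambda>t. y t $ 1)" "\<forall>t\<in>I. (t, y t, k) \<in> Phi_dom" for b I y k
    by (rule branch_solves [OF s that(1)]) (use that(2) in \<open>auto simp: Phi_dom_def abel_Phi_def\<close>)
  moreover have "\<exists>!k. \<forall>\<^sub>F t in nhds t0. (t, y t, k) \<in> Phi_dom \<and> x t = abel_Phi s (t, y t, k)"
    if y: "solves (abel b) I (\<lambda>t. y t $ 1)" and x: "solves (abel b) I x"
      and t0: "t0 \<in> I" "(t0, x t0, y t0) \<in> Psi_dom s" for b I y x t0
  proof (rule ex_ex1I)
    have cont: "isCont (\<lambda>t. s * (x t + t + 1)) t0" "isCont (\<lambda>t. y t $ 1 + t + 1) t0"
      using solves_isCont [OF x t0(1)] solves_isCont [OF y t0(1)]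
      by (auto intro!: continuous_intros)
    have "\<forall>\<^sub>F t in nhds t0. s * (x t + t + 1) > 0"
      by (rule order_tendstoD(1) [OF isCont_tendsto_nhds [OF cont(1)]])
        (use t0(2) in \<open>simp add: Psi_dom_def\<close>)
    moreover have "\<forall>\<^sub>F t in nhds t0. y t $ 1 + t + 1 \<noteq> 0"
      by (rule tendsto_imp_eventually_ne [OF isCont_tendsto_nhds [OF cont(2)]])
        (use t0(2) in \<open>simp add: Psi_dom_def\<close>)
    moreover have "\<forall>\<^sub>F t in nhds t0. t \<in> I"
      using x t0(1) by (auto simp: solves_def eventually_nhds)
    ultimately have
      "\<forall>\<^sub>F t in nhds t0. s * (x t + t + 1) > 0 \<and> y t $ 1 + t + 1 \<noteq> 0 \<and> t \<in> I"
      by eventually_elim simp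
    then obtain e where e: "e > 0" and
      J: "\<And>t. t \<in> ball t0 e \<Longrightarrow> s * (x t + t + 1) > 0 \<and> y t $ 1 + t + 1 \<noteq> 0 \<and> t \<in> I"
      unfolding eventually_nhds_metric by (auto simp: dist_commute)
    have "is_interval (ball t0 e)"
      by (simp add: is_interval_convex_1)
    moreover have "ball t0 e \<subseteq> I"
      using J by blast
    ultimately have "solves (abel b) (ball t0 e) x" "solves (abel b) (ball t0 e) (\<lambda>t. y t $ 1)"
      using solves_subset [OF x open_ball] solves_subset [OF y open_ball] by blast+
    moreover have "x t + t + 1 \<noteq> 0" "y t $ 1 + t + 1 \<noteq> 0" if "t \<in> ball t0 e" for t
      using J [OF that] by auto
    ultimately have "\<exists>k. \<forall>t\<in>ball t0 e. abel_Psi (t, x t, y t) = k"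
      by (rule abel_Psi_const)
    then obtain k where k: "\<And>t. t \<in> ball t0 e \<Longrightarrow> abel_Psi (t, x t, y t) = k"
      by blast
    have "(t, y t, k) \<in> Phi_dom \<and> x t = abel_Phi s (t, y t, k)" if t: "t \<in> ball t0 e" for t
      unfolding abel_Phi_Psi_iff [OF s] using J [OF t] k [OF t] by (simp add: Psi_dom_def)
    moreover have "\<forall>\<^sub>F t in nhds t0. t \<in> ball t0 e"
      using e by (intro eventually_nhds_in_open) auto
    ultimately have "\<forall>\<^sub>F t in nhds t0. (t, y t, k) \<in> Phi_dom \<and> x t = abel_Phi s (t, y t, k)"
      by (rule eventually_mono [rotated])
    then show "\<exists>k. \<forall>\<^sub>F t in nhds t0. (t, y t, k) \<in> Phi_dom \<and> x t = abel_Phi s (t, y t, k)" ..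
  next
    fix k l
    assume "\<forall>\<^sub>F t in nhds t0. (t, y t, k) \<in> Phi_dom \<and> x t = abel_Phi s (t, y t, k)"
      "\<forall>\<^sub>F t in nhds t0. (t, y t, l) \<in> Phi_dom \<and> x t = abel_Phi s (t, y t, l)"
    then have "(t0, y t0, k) \<in> Phi_dom \<and> x t0 = abel_Phi s (t0, y t0, k)"
      "(t0, y t0, l) \<in> Phi_dom \<and> x t0 = abel_Phi s (t0, y t0, l)"
      by (auto dest: eventually_nhds_x_imp_x)
    then show "k = l"
      unfolding abel_Phi_Psi_iff [OF s] by simp
  qed
  ultimately show ?thesis
    unfolding common_superposition_rule_def forall_1 using inverse_wrt_constants_abel [OF s]
    by blast
qed

section \<open>Genericity\<close>

definition abel_generic :: "(real \<times> real \<times> (real^1)) set" where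
  "abel_generic = {(t, x0, y). x0 + t + 1 \<noteq> 0 \<and> y $ 1 + t + 1 \<noteq> 0}"

lemma abel_generic_eq: "abel_generic = Psi_dom 1 \<union> Psi_dom (-1)"
  by (auto simp: abel_generic_def Psi_dom_def)

text \<open>Moving in the time direction leaves both excluded hyperplanes at once.\<close>

lemma closure_abel_generic: "closure abel_generic = UNIV"
proof -
  have "(t, x, y) \<in> closure abel_generic" for t x y
  proof (rule Lim_in_closed_set [OF closed_closure])
    have "\<forall>\<^sub>F r in at t. r \<noteq> - x - 1" "\<forall>\<^sub>F r in at t. r \<noteq> - (y $ 1) - 1"
      by (rule eventually_neq_at_within)+
    then show "\<forall>\<^sub>F r in at t. (r, x, y) \<in> closure abel_generic"
    proof eventually_elim
      case (elim r)
      then have "(r, x, y) \<in> abel_generic" by (auto simp: abel_generic_def)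
      then show ?case using closure_subset by blast
    qed
    show "((\<lambda>r. (r, x, y)) \<longlongrightarrow> (t, x, y)) (at t)"
      by (intro tendsto_intros)
  qed auto
  then show ?thesis by auto
qed

lemma implicit_rule_abel: "implicit_superposition_rule UNIV abel abel_generic abel_Psi"
proof -
  have "\<exists>k. \<forall>t\<in>I. k = abel_Psi (t, x t, y t)"
    if sol: "solves (abel b) I x" "solves (abel b) I (\<lambda>t. y t $ 1)"
      and gen: "\<forall>t\<in>I. (t, x t, y t) \<in> abel_generic" for b I x y
  proof -
    have "x t + t + 1 \<noteq> 0" "y t $ 1 + t + 1 \<noteq> 0" if "t \<in> I" for t
      using gen that by (auto simp: abel_generic_def)
    with sol have "\<exists>k. \<forall>t\<in>I. abel_Psi (t, x t, y t) = k"
      by (rule abel_Psi_const)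
    then show ?thesis by metis
  qed
  moreover have
    "\<exists>D W \<Phi>. common_superposition_rule UNIV abel D W \<Phi> abel_Psi \<and> p \<in> W \<and> W \<subseteq> abel_generic"
    if "p \<in> abel_generic" for p
  proof -
    define s :: real where "s = (if p \<in> Psi_dom 1 then 1 else - 1)"
    have s: "s = 1 \<or> s = -1" by (simp add: s_def)
    show ?thesis
    proof (intro exI conjI)
      show "common_superposition_rule UNIV abel Phi_dom (Psi_dom s) (abel_Phi s) abel_Psi"
        by (rule common_rule_abel [OF s])
      show "p \<in> Psi_dom s"
        using that by (auto simp: s_def abel_generic_eq)
      show "Psi_dom s \<subseteq> abel_generic"
        by (auto simp: s_def abel_generic_eq)
    qed
  qed
  moreover have "open abel_generic"
    unfolding abel_generic_eq by (intro open_Un open_Psi_dom)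
  ultimately show ?thesis
    unfolding implicit_superposition_rule_def forall_1 using closure_abel_generic by blast
qed

lemma implicit_superposition_rule_imp_Lie_family:
  fixes Y :: "'i \<Rightarrow> real \<Rightarrow> 'a::euclidean_space \<Rightarrow> 'a"
    and G :: "(real \<times> 'a \<times> ('a^'m::finite)) set"
  assumes "implicit_superposition_rule \<Lambda> Y G \<Psi>"
  shows "Lie_family TYPE('m) \<Lambda> Y"
  unfolding Lie_family_def
proof (rule exI [of _ G], intro conjI ballI)
  show "open G" "closure G = UNIV"
    using assms by (simp_all add: implicit_superposition_rule_def)
  show "\<exists>D W \<Phi> \<Psi>. common_superposition_rule \<Lambda> Y D W \<Phi> \<Psi> \<and> p \<in> W" if "p \<in> G" for p
  proof -
    have "\<exists>D W \<Phi>. common_superposition_rule \<Lambda> Y D W \<Phi> \<Psi> \<and> p \<in> W \<and> W \<subseteq> G"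
      using assms that unfolding implicit_superposition_rule_def by (elim conjE) (rule bspec)
    then show ?thesis by blast
  qed
qed

theorem mainTheorem3:
  shows "Lie_family TYPE(1) (UNIV :: (real \<Rightarrow> real) set) abel \<and>
    implicit_superposition_rule (UNIV :: (real \<Rightarrow> real) set) abel
      {(t, x0, y :: real^1). x0 + t + 1 \<noteq> 0 \<and> y $ 1 + t + 1 \<noteq> 0}
      (\<lambda>(t, x0, y). exp (2 * t) * ((x0 + t + 1) powi (-2) - (y $ 1 + t + 1) powi (-2))) \<and>
    (\<forall>(b :: real \<Rightarrow> real) I x1. solves (abel b) I x1 \<and> (\<forall>t\<in>I. x1 t + t + 1 \<noteq> 0) \<longrightarrow>
      (\<forall>x. solves (abel b) I x \<and> (\<forall>t\<in>I. x t + t + 1 > 0) \<longleftrightarrow>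
        (\<exists>k::real. \<forall>t\<in>I. (x1 t + t + 1) powi (-2) + k * exp (- 2 * t) > 0 \<and>
          x t = ((x1 t + t + 1) powi (-2) + k * exp (- 2 * t)) powr (- 1 / 2) - t - 1))) \<and>
    (\<forall>(b :: real \<Rightarrow> real) I x1. solves (abel b) I x1 \<and> (\<forall>t\<in>I. x1 t + t + 1 \<noteq> 0) \<longrightarrow>
      (\<forall>x. solves (abel b) I x \<and> (\<forall>t\<in>I. x t + t + 1 < 0) \<longleftrightarrow>
        (\<exists>k::real. \<forall>t\<in>I. (x1 t + t + 1) powi (-2) + k * exp (- 2 * t) > 0 \<and>
          x t = - (((x1 t + t + 1) powi (-2) + k * exp (- 2 * t)) powr (- 1 / 2)) - t - 1)))"
proof (intro conjI)
  show "Lie_family TYPE(1) (UNIV :: (real \<Rightarrow> real) set) abel"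
    by (rule implicit_superposition_rule_imp_Lie_family [OF implicit_rule_abel])
next
  show "implicit_superposition_rule (UNIV :: (real \<Rightarrow> real) set) abel
      {(t, x0, y :: real^1). x0 + t + 1 \<noteq> 0 \<and> y $ 1 + t + 1 \<noteq> 0}
      (\<lambda>(t, x0, y). exp (2 * t) * ((x0 + t + 1) powi (-2) - (y $ 1 + t + 1) powi (-2)))"
    using implicit_rule_abel unfolding abel_generic_def abel_Psi_def .
next
  show "\<forall>(b :: real \<Rightarrow> real) I x1. solves (abel b) I x1 \<and> (\<forall>t\<in>I. x1 t + t + 1 \<noteq> 0) \<longrightarrow>
      (\<forall>x. solves (abel b) I x \<and> (\<forall>t\<in>I. x t + t + 1 > 0) \<longleftrightarrow>
        (\<exists>k::real. \<forall>t\<in>I. (x1 t + t + 1) powi (-2) + k * exp (- 2 * t) > 0 \<and>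
          x t = ((x1 t + t + 1) powi (-2) + k * exp (- 2 * t)) powr (- 1 / 2) - t - 1))"
    by (intro allI impI abel_general_solution [of 1, unfolded mult_1_left]) simp_all
next
  have neg: "- 1 * c = - c" "0 < - c \<longleftrightarrow> c < 0" for c :: real
    by auto
  show "\<forall>(b :: real \<Rightarrow> real) I x1. solves (abel b) I x1 \<and> (\<forall>t\<in>I. x1 t + t + 1 \<noteq> 0) \<longrightarrow>
      (\<forall>x. solves (abel b) I x \<and> (\<forall>t\<in>I. x t + t + 1 < 0) \<longleftrightarrow>
        (\<exists>k::real. \<forall>t\<in>I. (x1 t + t + 1) powi (-2) + k * exp (- 2 * t) > 0 \<and>
          x t = - (((x1 t + t + 1) powi (-2) + k * exp (- 2 * t)) powr (- 1 / 2)) - t - 1))"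
  proof (intro allI impI)
    fix b I x1 x
    assume "solves (abel b) I x1 \<and> (\<forall>t\<in>I. x1 t + t + 1 \<noteq> 0)"
    then show "solves (abel b) I x \<and> (\<forall>t\<in>I. x t + t + 1 < 0) \<longleftrightarrow>
        (\<exists>k::real. \<forall>t\<in>I. (x1 t + t + 1) powi (-2) + k * exp (- 2 * t) > 0 \<and>
          x t = - (((x1 t + t + 1) powi (-2) + k * exp (- 2 * t)) powr (- 1 / 2)) - t - 1)"
      using abel_general_solution [of "- 1" b I x1 x, unfolded neg] by blast
  qed
qed

end
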